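(* Suppose that: (i) $\boldsymbol\xi$ is the uniform distribution on $[n]$, i.e., $\xi_j=1/n$ for all $j\in[n]$; (ii) there exist $M$ basic feasible solutions $\mathbf x^1,\dots,\mathbf x^M$ of $P$ that are within $\epsilon\ge 0$ of the optimal objective value, i.e., $\mathbf c^T\mathbf x^i-v(P)\le\epsilon$ for $i=1,\dots,M$; (iii) each variable $j\in[n]$ appears in at most $R$ of the corresponding bases $B^1,\dots,B^M$; (iv) there exists a value $x_{\max}$ such that $\|\mathbf x^i\|_\infty\le x_{\max}$ for all $i=1,\dots,M$. Then for $C=(nR/M)\cdot x_{\max}$, we have $\Delta v(P_{\mathrm{distr}})\le\epsilon$.
   Context: The complete problem is $P:\ \min\{\mathbf c^T\mathbf x\mid \mathbf A\mathbf x=\mathbf b,\ \mathbf x\ge \mathbf 0\}$ with $\mathbf A\in\mathbb R^{m\times n}$, $\mathbf b\in\mathbb R^m$, $\mathbf c\in\mathbb R^n$. Standing assumptions: $P$ is feasible and bounded, $\mathrm{rank}(\mathbf A)=m$, and $\|\mathbf c\|_2=1$. $[n]=\{1,\dots,n\}$. A basis is a set $B\subseteq[n]$ with $|B|=m$ and $\mathbf A_B$ nonsingular; the corresponding basic solution has $\mathbf x_B=\mathbf A_B^{-1}\mathbf b$ and all other components zero, and it is a basic feasible solution if it is nonnegative. In the statement $B^i$ is the basis giving $\mathbf x^i$. For a probability distribution $\boldsymbol\xi$ on $[n]$ and a constant $C\ge0$, $P_{\mathrm{distr}}:\ \min\{\mathbf c^T\mathbf x\mid\mathbf A\mathbf x=\mathbf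 b,\ \mathbf 0\le\mathbf x\le C\boldsymbol\xi\}$. $v(\cdot)$ denotes the optimal value ($+\infty$ for an infeasible minimization problem), and $\Delta v(P_{\mathrm{distr}})=v(P_{\mathrm{distr}})-v(P)$. *)

theory Defs
  imports "HOL-Analysis.Analysis" "HOL-Probability.Probability_Mass_Function"
begin

text \<open>
  An enumeration of the column indices in \<open>B\<close> by the row indices, needed to regard \<open>A\<^sub>B\<close> as a square
  matrix. The choice is irrelevant: see \<open>is_basis_iff_any_enum\<close> and \<open>basic_solution_unique\<close>.
\<close>
definition basis_enum :: "'n::finite set \<Rightarrow> 'm::finite \<Rightarrow> 'n" where
  "basis_enum B = (SOME e. bij_betw e UNIV B)"

definition basis_matrix :: "real^'n^'m \<Rightarrow> 'n set \<Rightarrow> real^'m^'m" where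
  "basis_matrix A B = (\<chi> i k. A $ i $ basis_enum B k)"

definition is_basis :: "real^'n^'m \<Rightarrow> 'n set \<Rightarrow> bool" where
  "is_basis A B \<longleftrightarrow> card B = CARD('m) \<and> invertible (basis_matrix A B)"

definition basic_solution :: "real^'n^'m \<Rightarrow> real^'m \<Rightarrow> 'n set \<Rightarrow> real^'n" where
  "basic_solution A b B =
     (\<chi> j. if j \<in> B
           then (matrix_inv (basis_matrix A B) *v b) $ inv_into UNIV (basis_enum B) j
           else 0)"

definition is_bfs_with_basis ::
    "real^'n^'m \<Rightarrow> real^'m \<Rightarrow> real^'n \<Rightarrow> 'n set \<Rightarrow> bool" where
  "is_bfs_with_basis A b x B \<longleftrightarrow> is_basis A B \<and> x = basic_solution A b B \<and> 0 \<le> x"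

definition feasible_P :: "real^'n^'m \<Rightarrow> real^'m \<Rightarrow> (real^'n) set" where
  "feasible_P A b = {x. A *v x = b \<and> 0 \<le> x}"

definition feasible_distr ::
    "real^'n^'m \<Rightarrow> real^'m \<Rightarrow> 'n pmf \<Rightarrow> real \<Rightarrow> (real^'n) set" where
  "feasible_distr A b \<xi> C = {x. A *v x = b \<and> 0 \<le> x \<and> x \<le> C *\<^sub>R (\<chi> j. pmf \<xi> j)}"

text \<open>The infimum over the empty set in \<^typ>\<open>ereal\<close> is \<open>\<infinity>\<close>, as wanted for infeasible problems.\<close>
definition opt_value :: "real^'n \<Rightarrow> (real^'n) set \<Rightarrow> ereal" where
  "opt_value c S = (INF x\<in>S. ereal (c \<bullet> x))"

definition v_P :: "real^'n^'m \<Rightarrow> real^'m \<Rightarrow> real^'n \<Rightarrow> ereal" where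
  "v_P A b c = opt_value c (feasible_P A b)"

definition v_distr ::
    "real^'n^'m \<Rightarrow> real^'m \<Rightarrow> real^'n \<Rightarrow> 'n pmf \<Rightarrow> real \<Rightarrow> ereal" where
  "v_distr A b c \<xi> C = opt_value c (feasible_distr A b \<xi> C)"

definition delta_v_distr ::
    "real^'n^'m \<Rightarrow> real^'m \<Rightarrow> real^'n \<Rightarrow> 'n pmf \<Rightarrow> real \<Rightarrow> ereal" where
  "delta_v_distr A b c \<xi> C = v_distr A b c \<xi> C - v_P A b c"

lemma basis_enum_bij:
  fixes B :: "'n::finite set"
  assumes "card B = CARD('m::finite)"
  shows "bij_betw (basis_enum B :: 'm \<Rightarrow> 'n) UNIV B"
proof -
  have "\<exists>e :: 'm \<Rightarrow> 'n. bij_betw e UNIV B"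
    using assms by (intro finite_same_card_bij) auto
  then show ?thesis
    unfolding basis_enum_def by (rule someI_ex)
qed

lemma mult_supported_on_enum:
  fixes A :: "real^'n^'m" and e :: "'m \<Rightarrow> 'n"
  assumes e: "bij_betw e UNIV B" and y: "\<And>j. j \<notin> B \<Longrightarrow> y $ j = 0"
  shows "A *v y = (\<chi> i k. A $ i $ e k) *v (\<chi> k. y $ e k)"
proof -
  have "(\<Sum>j\<in>UNIV. A $ i $ j * y $ j) = (\<Sum>k\<in>UNIV. A $ i $ e k * y $ e k)" for i
  proof -
    have "(\<Sum>j\<in>UNIV. A $ i $ j * y $ j) = (\<Sum>j\<in>B. A $ i $ j * y $ j)"
      by (rule sum.mono_neutral_right) (auto simp: y)
    also have "\<dots> = (\<Sum>k\<in>UNIV. A $ i $ e k * y $ e k)"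
      using sum.reindex_bij_betw[OF e, of "\<lambda>j. A $ i $ j * y $ j"] by simp
    finally show ?thesis .
  qed
  then show ?thesis
    by (simp add: matrix_vector_mult_def vec_eq_iff)
qed

lemma invertible_iff_supported_kernel:
  fixes A :: "real^'n^'m" and e :: "'m \<Rightarrow> 'n"
  assumes e: "bij_betw e UNIV B"
  shows "invertible (\<chi> i k. A $ i $ e k) \<longleftrightarrow>
    (\<forall>y. (\<forall>j. j \<notin> B \<longrightarrow> y $ j = 0) \<and> A *v y = 0 \<longrightarrow> y = 0)"
proof -
  let ?M = "\<chi> i k. A $ i $ e k"
  have inj: "inj e" and img: "e ` UNIV = B"
    using e by (auto simp: bij_betw_def)
  have "invertible ?M \<longleftrightarrow> (\<forall>z. ?M *v z = 0 \<longrightarrow> z = 0)"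
    by (simp add: invertible_left_inverse matrix_left_invertible_ker)
  also have "\<dots> \<longleftrightarrow> (\<forall>y. (\<forall>j. j \<notin> B \<longrightarrow> y $ j = 0) \<and> A *v y = 0 \<longrightarrow> y = 0)"
  proof (intro iffI allI impI)
    fix y assume L: "\<forall>z. ?M *v z = 0 \<longrightarrow> z = 0"
      and y: "(\<forall>j. j \<notin> B \<longrightarrow> y $ j = 0) \<and> A *v y = 0"
    have "(\<chi> k. y $ e k) = 0"
      using L y mult_supported_on_enum[OF e, of y A] by auto
    then have "y $ e k = 0" for k
      by (simp add: vec_eq_iff)
    then show "y = 0"
      using y img by (auto simp: vec_eq_iff) (metis rangeE)
  next
    fix z assume R: "\<forall>y. (\<forall>j. j \<notin> B \<longrightarrow> y $ j = 0) \<and> A *v y = 0 \<longrightarrow> y = 0"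
      and z: "?M *v z = 0"
    define y :: "real^'n" where "y = (\<chi> j. if j \<in> B then z $ inv_into UNIV e j else 0)"
    have ye: "y $ e k = z $ k" for k
      using img inj by (auto simp: y_def)
    have supp: "y $ j = 0" if "j \<notin> B" for j
      using that by (simp add: y_def)
    have "A *v y = 0"
      using mult_supported_on_enum[OF e, of y A] supp z by (simp add: ye)
    then have "y = 0"
      using R supp by blast
    then show "z = 0"
      using ye by (auto simp: vec_eq_iff)
  qed
  finally show ?thesis .
qed

lemma is_basis_iff_any_enum:
  fixes A :: "real^'n^'m" and e :: "'m \<Rightarrow> 'n"
  assumes e: "bij_betw e UNIV B"
  shows "is_basis A B \<longleftrightarrow> invertible (\<chi> i k. A $ i $ e k)"
proof -
  have c: "card B = CARD('m)"
    using bij_betw_same_card[OF e] by simp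
  show ?thesis
    unfolding is_basis_def basis_matrix_def
    using c invertible_iff_supported_kernel[OF e, of A]
      invertible_iff_supported_kernel[OF basis_enum_bij[OF c], of A] by blast
qed

lemma basic_solution_outside: "j \<notin> B \<Longrightarrow> basic_solution A b B $ j = 0"
  by (simp add: basic_solution_def)

lemma basic_solution_solves:
  fixes A :: "real^'n^'m"
  assumes "is_basis A B"
  shows "A *v basic_solution A b B = b"
proof -
  have c: "card B = CARD('m)" and inv: "invertible (basis_matrix A B)"
    using assms by (auto simp: is_basis_def)
  note e = basis_enum_bij[OF c]
  have "basic_solution A b B $ basis_enum B k = (matrix_inv (basis_matrix A B) *v b) $ k" for k
    using e by (auto simp: basic_solution_def bij_betw_def)
  then have "A *v basic_solution A b B = basis_matrix A B *v (matrix_inv (basis_matrix A B) *v b)"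
    using mult_supported_on_enum[OF e, of "basic_solution A b B" A]
    by (simp add: basic_solution_outside basis_matrix_def)
  moreover have "basis_matrix A B ** matrix_inv (basis_matrix A B) = mat 1"
    using inv unfolding invertible_def matrix_inv_def by (rule someI2_ex) simp
  ultimately show ?thesis
    by (simp add: matrix_vector_mul_assoc)
qed

lemma basic_solution_unique:
  fixes A :: "real^'n^'m"
  assumes B: "is_basis A B" and "A *v y = b" and "\<And>j. j \<notin> B \<Longrightarrow> y $ j = 0"
  shows "y = basic_solution A b B"
proof -
  have c: "card B = CARD('m)"
    using B by (simp add: is_basis_def)
  have "A *v (y - basic_solution A b B) = 0"
    using assms basic_solution_solves[OF B, of b] by (simp add: matrix_vector_mult_diff_distrib)
  moreover have "\<forall>j. j \<notin> B \<longrightarrow> (y - basic_solution A b B) $ j = 0"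
    using assms(3) by (simp add: basic_solution_outside)
  moreover have "invertible (\<chi> i (k::'m). A $ i $ basis_enum B k)"
    using B by (simp add: is_basis_def basis_matrix_def)
  ultimately have "y - basic_solution A b B = 0"
    using invertible_iff_supported_kernel[OF basis_enum_bij[OF c], of A] by blast
  then show ?thesis
    by simp
qed

end

theory Submission
  imports Defs
begin

text \<open>
  The average of the \<open>x\<^sup>i\<close> is feasible for \<open>P\<close> by convexity, and its objective value is within
  \<open>\<epsilon>\<close> of the optimum by linearity. Its \<open>j\<close>-th component is at most \<open>(R / M) x_max = C / n\<close>, since
  \<open>x\<^sup>i\<close> vanishes outside \<open>B\<^sup>i\<close> and so at most \<open>R\<close> of the summands are nonzero.
\<close>

lemma convex_feasible_P: "convex (feasible_P A b)"
  unfolding convex_def feasible_P_def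
  by (auto simp: matrix_vector_right_distrib matrix_vector_mult_scaleR less_eq_vec_def
      simp flip: scaleR_left_distrib)

lemma is_bfs_with_basis_feasible:
  "is_bfs_with_basis A b x B \<Longrightarrow> x \<in> feasible_P A b"
  by (auto simp: is_bfs_with_basis_def feasible_P_def basic_solution_solves)

lemma is_bfs_with_basis_outside:
  "is_bfs_with_basis A b x B \<Longrightarrow> j \<notin> B \<Longrightarrow> x $ j = 0"
  by (auto simp: is_bfs_with_basis_def basic_solution_outside)

text \<open>A feasible point rules out the value \<infinity> and a lower bound rules out
  -\<infinity>. With a real optimum, gaps in \<open>ereal\<close> turn into ordinary real
  inequalities.\<close>

lemma opt_value_finite:
  assumes "S \<noteq> {}" and "bdd_below ((\<bullet>) c ` S)"
  obtains p where "opt_value c S = ereal p"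
proof -
  obtain y where "y \<in> S"
    using assms(1) by auto
  then have "opt_value c S \<le> ereal (c \<bullet> y)"
    unfolding opt_value_def by (rule INF_lower)
  moreover obtain l where "\<And>y. y \<in> S \<Longrightarrow> l \<le> c \<bullet> y"
    using assms(2) by (auto simp: bdd_below_def)
  then have "ereal l \<le> opt_value c S"
    unfolding opt_value_def by (intro INF_greatest) auto
  ultimately show ?thesis
    using that by (cases "opt_value c S") auto
qed

text \<open>Only the indices in \<open>J\<close> contribute, each at most \<open>u\<close>;
  \<open>0 \<le> u\<close> then allows their number to be raised to \<open>R\<close>.\<close>

lemma sum_le_card_support:
  fixes f :: "'a \<Rightarrow> real"
  assumes "finite I" and "\<And>i. i \<in> I \<Longrightarrow> i \<notin> J \<Longrightarrow> f i = 0"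
    and "\<And>i. i \<in> I \<Longrightarrow> f i \<le> u" and "0 \<le> u" and "card {i \<in> I. i \<in> J} \<le> R"
  shows "sum f I \<le> real R * u"
proof -
  have "sum f I = sum f {i \<in> I. i \<in> J}"
    using assms by (intro sum.mono_neutral_right) auto
  also have "\<dots> \<le> real (card {i \<in> I. i \<in> J}) * u"
    using assms by (intro sum_bounded_above) auto
  also have "\<dots> \<le> real R * u"
    using assms by (intro mult_right_mono) auto
  finally show ?thesis .
qed

theorem theorem3:
  fixes A :: "real^'n^'m" and b :: "real^'m" and c :: "real^'n"
    and \<xi> :: "'n pmf"
    and M R :: nat and \<epsilon> x_max C :: real
    and x :: "nat \<Rightarrow> real^'n" and B :: "nat \<Rightarrow> 'n set"
  assumes feasible: "feasible_P A b \<noteq> {}"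
    and bounded: "bdd_below ((\<lambda>x. c \<bullet> x) ` feasible_P A b)"
    and full_rank: "rank A = CARD('m)"
    and norm_c: "norm c = 1"
    and uniform: "\<forall>j. pmf \<xi> j = 1 / real CARD('n)"
    and eps: "\<epsilon> \<ge> 0"
    and M_pos: "M \<ge> 1"
    and bfs: "\<forall>i\<in>{1..M}. is_bfs_with_basis A b (x i) (B i)"
    and near_opt: "\<forall>i\<in>{1..M}. ereal (c \<bullet> x i) - v_P A b c \<le> ereal \<epsilon>"
    and appears: "\<forall>j. card {i\<in>{1..M}. j \<in> B i} \<le> R"
    and x_max: "\<forall>i\<in>{1..M}. infnorm (x i) \<le> x_max"
    and C: "C = (real CARD('n) * real R / real M) * x_max"
  shows "delta_v_distr A b c \<xi> C \<le> ereal \<epsilon>"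
proof -
  define y where "y = (\<Sum>i\<in>{1..M}. (1 / real M) *\<^sub>R x i)"
  obtain p where p: "v_P A b c = ereal p"
    using opt_value_finite [OF feasible bounded] unfolding v_P_def .
  have y_P: "y \<in> feasible_P A b"
    unfolding y_def using convex_feasible_P
    by (rule convex_sum [rotated]) (use M_pos bfs in \<open>auto intro: is_bfs_with_basis_feasible\<close>)
  \<comment> \<open>Since \<open>M \<ge> 1\<close>, the point \<open>x 1\<close> exists, and its
    norm is nonnegative.\<close>
  have x_max_nonneg: "0 \<le> x_max"
    using M_pos x_max infnorm_pos_le [of "x 1"] by (meson atLeastAtMost_iff order_refl order_trans)
  \<comment> \<open>The factor n in \<open>C\<close> cancels the uniform probability 1/n, so the
    right-hand side is \<open>R * x_max / M\<close>.\<close>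
  have "y $ j \<le> C * pmf \<xi> j" for j
  proof -
    have "(\<Sum>i\<in>{1..M}. x i $ j) \<le> real R * x_max"
    proof (rule sum_le_card_support [where J = "{i. j \<in> B i}"])
      fix i assume i: "i \<in> {1..M}"
      show "x i $ j = 0" if "i \<notin> {i. j \<in> B i}"
        using that bfs i is_bfs_with_basis_outside by blast
      show "x i $ j \<le> x_max"
        using x_max i component_le_infnorm_cart [of "x i" j] by fastforce
    qed (use appears x_max_nonneg in auto)
    then show ?thesis
      using M_pos by (simp add: y_def C uniform divide_simps flip: sum_divide_distrib)
  qed
  then have "y \<in> feasible_distr A b \<xi> C"
    using y_P by (simp add: feasible_P_def feasible_distr_def less_eq_vec_def)
  then have "v_distr A b c \<xi> C \<le> ereal (c \<bullet> y)"
    unfolding v_distr_def opt_value_def by (rule INF_lower)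
  moreover have "c \<bullet> y \<le> p + \<epsilon>"
  proof -
    \<comment> \<open>As \<open>v_P A b c\<close> is the real \<open>p\<close>, each summand is at
      most \<open>p + \<epsilon>\<close>; dividing by \<open>M\<close> gives the average.\<close>
    have "(\<Sum>i\<in>{1..M}. c \<bullet> x i) \<le> real (card {1..M}) * (p + \<epsilon>)"
      using near_opt by (intro sum_bounded_above) (force simp: p)
    then show ?thesis
      using M_pos by (simp add: y_def inner_sum_right divide_simps mult.commute
          flip: sum_divide_distrib)
  qed
  ultimately have "v_distr A b c \<xi> C \<le> ereal (p + \<epsilon>)"
    using order_trans ereal_less_eq(3) by blast
  \<comment> \<open>The bound excludes \<infinity>; at -\<infinity> the difference is -\<infinity>,
    and a real value leaves real arithmetic.\<close>
  then show ?thesis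
    unfolding delta_v_distr_def p by (cases "v_distr A b c \<xi> C") auto
qed

end
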